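(* The category $\mathbf{Pol}$ of polarities and compatible relations is dually equivalent to the category $\mathbf{INF}$ of complete lattices and functions preserving arbitrary infima.
   Context: For a binary relation $R\subseteq A\times B$ between sets, define antitone maps $R^{\downarrow}:\mathcal{P}(B)\to\mathcal{P}(A)$ and $R^{\uparrow}:\mathcal{P}(A)\to\mathcal{P}(B)$ by $R^{\downarrow}(Y)=\{a\in A\mid a\mathrel{R}\beta\text{ for all }\beta\in Y\}$ and $R^{\uparrow}(X)=\{\beta\in B\mid a\mathrel{R}\beta\text{ for all }a\in X\}$. Juxtaposition of such maps denotes composition, the rightmost map being applied first. A polarity $\mathcal{A}=(A^-,A^+;\mathcal{A})$ consists of two sets $A^-,A^+$ and a binary relation $\mathcal{A}\subseteq A^-\times A^+$ (its incidence relation, denoted by the same letter). Put $\mathrm{cl}_{\mathcal{A}}=\mathcal{A}^{\downarrow}\mathcal{A}^{\uparrow}$ on $\mathcal{P}(A^-)$ and $\mathrm{cl}^{\mathcal{A}}=\mathcal{A}^{\uparrow}\mathcal{A}^{\downarrow}$ on $\mathcal{P}(A^+)$. For polarities $\mathcal{A},\mathcal{B}$, a relation $R\subseteq A^-\times B^+$ is a compatible relation from $\mathcal{A}$ to $\mathcal{B}$ if $\mathrm{cl}_{\mathcal{A}}R^{\downarrow}=R^{\downarrow}$ and $R^{\downarrow}\mathrm{cl}^{\mathcal{B}}=R^{\downarrow}$. $\mathbf{Pol}$ is the category whose objects are polarities and whose morphisms $\mathcal{A}\to\mathcal{B}$ are the compatible relations from $\mathcal{A}$ to $\mathcal{B}$.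 The composite of $R:\mathcal{A}\to\mathcal{B}$ and $S:\mathcal{B}\to\mathcal{C}$ (written in diagrammatic order) is the relation $R\mathbin{;}S\subseteq A^-\times C^+$ with $a\mathrel{(R\mathbin{;}S)}\gamma$ if and only if $a\in R^{\downarrow}\mathcal{B}^{\uparrow}S^{\downarrow}(\{\gamma\})$. The identity on $\mathcal{A}$ is its incidence relation. *)

theory Defs
  imports
    "HOL-Algebra.Complete_Lattice"
    "HOL-Library.FuncSet"
    "HOL-Library.Equipollence"
begin

section \<open>Categories, functors, equivalence\<close>

text \<open>
  Hom-sets of different pairs of objects may overlap, so identities and composition take the
  objects as arguments. Composition is written in diagrammatic order: for
  f in Hom C X Y and g in Hom C Y Z, the term Comp C X Y Z f g is "first f, then g".
\<close>

record ('o, 'm) category =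
  Ob :: "'o set"
  Hom :: "'o \<Rightarrow> 'o \<Rightarrow> 'm set"
  Idn :: "'o \<Rightarrow> 'm"
  Comp :: "'o \<Rightarrow> 'o \<Rightarrow> 'o \<Rightarrow> 'm \<Rightarrow> 'm \<Rightarrow> 'm"

definition is_category :: "('o, 'm) category \<Rightarrow> bool" where
  "is_category C \<longleftrightarrow>
     (\<forall>X\<in>Ob C. Idn C X \<in> Hom C X X) \<and>
     (\<forall>X\<in>Ob C. \<forall>Y\<in>Ob C. \<forall>Z\<in>Ob C. \<forall>f\<in>Hom C X Y. \<forall>g\<in>Hom C Y Z.
        Comp C X Y Z f g \<in> Hom C X Z) \<and>
     (\<forall>X\<in>Ob C. \<forall>Y\<in>Ob C. \<forall>f\<in>Hom C X Y.
        Comp C X X Y (Idn C X) f = f \<and> Comp C X Y Y f (Idn C Y) = f) \<and>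
     (\<forall>W\<in>Ob C. \<forall>X\<in>Ob C. \<forall>Y\<in>Ob C. \<forall>Z\<in>Ob C.
        \<forall>f\<in>Hom C W X. \<forall>g\<in>Hom C X Y. \<forall>h\<in>Hom C Y Z.
        Comp C W Y Z (Comp C W X Y f g) h = Comp C W X Z f (Comp C X Y Z g h))"

definition opposite :: "('o, 'm) category \<Rightarrow> ('o, 'm) category" where
  "opposite C = \<lparr>Ob = Ob C, Hom = (\<lambda>X Y. Hom C Y X), Idn = Idn C,
                 Comp = (\<lambda>X Y Z f g. Comp C Z Y X g f)\<rparr>"

definition full_subcategory :: "('o, 'm) category \<Rightarrow> 'o set \<Rightarrow> ('o, 'm) category" where
  "full_subcategory C P = C\<lparr>Ob := Ob C \<inter> P\<rparr>"

definition is_iso :: "('o, 'm) category \<Rightarrow> 'o \<Rightarrow> 'o \<Rightarrow> 'm \<Rightarrow> bool" where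
  "is_iso C X Y f \<longleftrightarrow> f \<in> Hom C X Y \<and>
     (\<exists>g\<in>Hom C Y X. Comp C X Y X f g = Idn C X \<and> Comp C Y X Y g f = Idn C Y)"

record ('o, 'm, 'p, 'n) cat_functor =
  on_ob :: "'o \<Rightarrow> 'p"
  on_hom :: "'o \<Rightarrow> 'o \<Rightarrow> 'm \<Rightarrow> 'n"

definition is_functor ::
  "('o, 'm) category \<Rightarrow> ('p, 'n) category \<Rightarrow> ('o, 'm, 'p, 'n) cat_functor \<Rightarrow> bool" where
  "is_functor C D F \<longleftrightarrow>
     (\<forall>X\<in>Ob C. on_ob F X \<in> Ob D) \<and>
     (\<forall>X\<in>Ob C. \<forall>Y\<in>Ob C. \<forall>f\<in>Hom C X Y.
        on_hom F X Y f \<in> Hom D (on_ob F X) (on_ob F Y)) \<and>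
     (\<forall>X\<in>Ob C. on_hom F X X (Idn C X) = Idn D (on_ob F X)) \<and>
     (\<forall>X\<in>Ob C. \<forall>Y\<in>Ob C. \<forall>Z\<in>Ob C. \<forall>f\<in>Hom C X Y. \<forall>g\<in>Hom C Y Z.
        on_hom F X Z (Comp C X Y Z f g) =
        Comp D (on_ob F X) (on_ob F Y) (on_ob F Z) (on_hom F X Y f) (on_hom F Y Z g))"

definition id_functor :: "('o, 'm, 'o, 'm) cat_functor" where
  "id_functor = \<lparr>on_ob = (\<lambda>X. X), on_hom = (\<lambda>X Y f. f)\<rparr>"

text \<open>First F, then G.\<close>

definition then_functor ::
  "('o, 'm, 'p, 'n) cat_functor \<Rightarrow> ('p, 'n, 'q, 'k) cat_functor \<Rightarrow> ('o, 'm, 'q, 'k) cat_functor" where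
  "then_functor F G = \<lparr>on_ob = (\<lambda>X. on_ob G (on_ob F X)),
     on_hom = (\<lambda>X Y f. on_hom G (on_ob F X) (on_ob F Y) (on_hom F X Y f))\<rparr>"

definition natural_iso :: "('o, 'm) category \<Rightarrow> ('p, 'n) category \<Rightarrow>
    ('o, 'm, 'p, 'n) cat_functor \<Rightarrow> ('o, 'm, 'p, 'n) cat_functor \<Rightarrow> ('o \<Rightarrow> 'n) \<Rightarrow> bool" where
  "natural_iso C D F G \<eta> \<longleftrightarrow>
     (\<forall>X\<in>Ob C. is_iso D (on_ob F X) (on_ob G X) (\<eta> X)) \<and>
     (\<forall>X\<in>Ob C. \<forall>Y\<in>Ob C. \<forall>f\<in>Hom C X Y.
        Comp D (on_ob F X) (on_ob F Y) (on_ob G Y) (on_hom F X Y f) (\<eta> Y) =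
        Comp D (on_ob F X) (on_ob G X) (on_ob G Y) (\<eta> X) (on_hom G X Y f))"

definition equivalent_categories :: "('o, 'm) category \<Rightarrow> ('p, 'n) category \<Rightarrow> bool" where
  "equivalent_categories C D \<longleftrightarrow> is_category C \<and> is_category D \<and>
     (\<exists>F G \<eta> \<epsilon>. is_functor C D F \<and> is_functor D C G \<and>
        natural_iso C C id_functor (then_functor F G) \<eta> \<and>
        natural_iso D D (then_functor G F) id_functor \<epsilon>)"

definition dually_equivalent :: "('o, 'm) category \<Rightarrow> ('p, 'n) category \<Rightarrow> bool" where
  "dually_equivalent C D \<longleftrightarrow> equivalent_categories (opposite C) D"


section \<open>Polarities and compatible relations\<close>

record 'u polarity =
  Neg :: "'u set"
  Pos :: "'u set"
  Inc :: "('u \<times> 'u) set"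

definition is_polarity :: "'u polarity \<Rightarrow> bool" where
  "is_polarity A \<longleftrightarrow> Inc A \<subseteq> Neg A \<times> Pos A"

text \<open>
  The maps of a relation R from A to B: lower A R is the map from subsets of B to subsets of A,
  upper B R the map from subsets of A to subsets of B. Only the set in which the result
  lives has to be supplied.
\<close>

definition lower :: "'a set \<Rightarrow> ('a \<times> 'b) set \<Rightarrow> 'b set \<Rightarrow> 'a set" where
  "lower A R Y = {a\<in>A. \<forall>\<beta>\<in>Y. (a, \<beta>) \<in> R}"

definition upper :: "'b set \<Rightarrow> ('a \<times> 'b) set \<Rightarrow> 'a set \<Rightarrow> 'b set" where
  "upper B R X = {\<beta>\<in>B. \<forall>a\<in>X. (a, \<beta>) \<in> R}"

definition cl_neg :: "'u polarity \<Rightarrow> 'u set \<Rightarrow> 'u set" where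
  "cl_neg A X = lower (Neg A) (Inc A) (upper (Pos A) (Inc A) X)"

definition cl_pos :: "'u polarity \<Rightarrow> 'u set \<Rightarrow> 'u set" where
  "cl_pos A Y = upper (Pos A) (Inc A) (lower (Neg A) (Inc A) Y)"

definition compatible :: "'u polarity \<Rightarrow> 'u polarity \<Rightarrow> ('u \<times> 'u) set \<Rightarrow> bool" where
  "compatible A B R \<longleftrightarrow> R \<subseteq> Neg A \<times> Pos B \<and>
     (\<forall>Y\<subseteq>Pos B. cl_neg A (lower (Neg A) R Y) = lower (Neg A) R Y) \<and>
     (\<forall>Y\<subseteq>Pos B. lower (Neg A) R (cl_pos B Y) = lower (Neg A) R Y)"

definition rel_then :: "'u polarity \<Rightarrow> 'u polarity \<Rightarrow> 'u polarity \<Rightarrow>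
    ('u \<times> 'u) set \<Rightarrow> ('u \<times> 'u) set \<Rightarrow> ('u \<times> 'u) set" where
  "rel_then A B C R S = {(a, \<gamma>). a \<in> Neg A \<and> \<gamma> \<in> Pos C \<and>
     a \<in> lower (Neg A) R (upper (Pos B) (Inc B) (lower (Neg B) S {\<gamma>}))}"


section \<open>Universes and the two categories\<close>

text \<open>
  HOL has no type of all sets. So, as usual for large categories, "all" polarities and
  "all" complete lattices are those whose underlying sets belong to a given universe, here
  a family U of subsets of a type. Of the closure properties of a Grothendieck universe only
  two are required: closure under subsets and, up to bijection, under power sets.
\<close>

definition universe :: "'u set set \<Rightarrow> bool" where
  "universe U \<longleftrightarrow>
     (\<forall>X\<in>U. \<forall>Y\<subseteq>X. Y \<in> U) \<and>
     (\<forall>X\<in>U. \<exists>Y\<in>U. Pow X \<approx> Y)"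

definition Pol :: "'u set set \<Rightarrow> ('u polarity, ('u \<times> 'u) set) category" where
  "Pol U = \<lparr>Ob = {A. is_polarity A \<and> Neg A \<in> U \<and> Pos A \<in> U},
            Hom = (\<lambda>A B. {R. compatible A B R}),
            Idn = Inc,
            Comp = rel_then\<rparr>"

text \<open>
  A morphism is a function on the carrier; it is made unique as a HOL function by being
  undefined outside the carrier. The infima preserved include the empty one, the top element.
\<close>

definition INF_cat :: "'u set set \<Rightarrow> ('u gorder, 'u \<Rightarrow> 'u) category" where
  "INF_cat U = \<lparr>Ob = {L. complete_lattice L \<and> carrier L \<in> U},
            Hom = (\<lambda>L M. {f \<in> carrier L \<rightarrow>\<^sub>E carrier M. inf_pres L M f}),
            Idn = (\<lambda>L. \<lambda>x\<in>carrier L. x),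
            Comp = (\<lambda>L M N f g. compose (carrier L) g f)\<rparr>"

text \<open>
  Universes with an infinite member cannot be proved to exist in HOL. The following size
  condition makes sense for any family U whatsoever, in particular for the family of all
  subsets of a type: the lattice of closed sets of A is as large as some member of U. In a universe
  it always holds for polarities with underlying sets in U. For the family of all subsets, every
  polarity between types 'a and 'b has an isomorphic copy satisfying it over the type
  ('a + 'b) set.
\<close>

definition closed_sets :: "'u polarity \<Rightarrow> 'u set set" where
  "closed_sets A = {X. X \<subseteq> Neg A \<and> cl_neg A X = X}"

definition concept_small :: "'u set set \<Rightarrow> 'u polarity set" where
  "concept_small U = {A. \<exists>X\<in>U. closed_sets A \<approx> X}"

end

theory Submission
  imports Defs
begin

text \<open>
  The duality sends a polarity \<open>A\<close> to its complete lattice of closed sets, the concept lattice, and a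
  compatible relation \<open>R\<close> from \<open>A\<close> to \<open>B\<close> to the map that takes a closed set \<open>X\<close> of \<open>B\<close> to
  \<open>R\<^sup>\<down> B\<^sup>\<up> X\<close>, a closed set of \<open>A\<close>. Meets of closed sets are intersections, and every closed set
  of \<open>B\<close> is an intersection of sets \<open>B\<^sup>\<down> {\<beta>}\<close>. So a meet preserving map \<open>g\<close> of concept lattices is
  determined by its values at the sets \<open>B\<^sup>\<down> {\<beta>}\<close>, and a compatible relation is exactly a table of
  such values: \<open>a\<close> is related to \<open>\<beta>\<close> iff \<open>a \<in> g (B\<^sup>\<down> {\<beta>})\<close>. Hence the assignment is bijective on
  hom-sets (\<open>compatible_eqI\<close>, \<open>compatible_exists\<close>), and it turns the composition of relations into
  the composition of maps in the reverse order (\<open>concept_map_rel_then\<close>).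

  Every complete lattice \<open>L\<close> arises up to isomorphism, namely from its order relation regarded as a
  polarity: the closed sets are then the principal down-sets, since a set of common lower bounds is the
  down-set of an infimum (\<open>closed_sets_order_polarity\<close>). A functor that is bijective on hom-sets
  and reaches every isomorphism class is an equivalence.

  A closed set is a subset and not an element of the base type, so the concept lattice
  has to be transported to a member of \<open>U\<close>. This is possible precisely for the polarities in
  \<open>concept_small U\<close>, and in a universe all polarities belong to it (\<open>universe_concept_small\<close>). Thus the
  claim about universes is the special case of the other one in which the full subcategory is
  everything.
\<close>

section \<open>Fully faithful functors\<close>

text \<open>Equations between morphisms of \<open>C\<close> can be tested on their images in \<open>D\<close>, so \<open>C\<close> inherits
  the unit and associativity laws from \<open>D\<close>. In the application this derives the category laws
  for compatible relations from those for functions.\<close>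

locale fully_faithful_functor =
  fixes C :: "('o, 'm) category" and D :: "('p, 'n) category"
    and F :: "('o, 'm, 'p, 'n) cat_functor"
  assumes target_category: "is_category D"
    and Idn_in_Hom: "\<And>X. X \<in> Ob C \<Longrightarrow> Idn C X \<in> Hom C X X"
    and Comp_in_Hom: "\<And>X Y Z f g. \<lbrakk>X \<in> Ob C; Y \<in> Ob C; Z \<in> Ob C; f \<in> Hom C X Y; g \<in> Hom C Y Z\<rbrakk>
          \<Longrightarrow> Comp C X Y Z f g \<in> Hom C X Z"
    and on_ob_in: "\<And>X. X \<in> Ob C \<Longrightarrow> on_ob F X \<in> Ob D"
    and on_hom_bij: "\<And>X Y. \<lbrakk>X \<in> Ob C; Y \<in> Ob C\<rbrakk>
          \<Longrightarrow> bij_betw (on_hom F X Y) (Hom C X Y) (Hom D (on_ob F X) (on_ob F Y))"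
    and on_hom_Idn: "\<And>X. X \<in> Ob C \<Longrightarrow> on_hom F X X (Idn C X) = Idn D (on_ob F X)"
    and on_hom_Comp: "\<And>X Y Z f g. \<lbrakk>X \<in> Ob C; Y \<in> Ob C; Z \<in> Ob C; f \<in> Hom C X Y; g \<in> Hom C Y Z\<rbrakk>
          \<Longrightarrow> on_hom F X Z (Comp C X Y Z f g) =
              Comp D (on_ob F X) (on_ob F Y) (on_ob F Z) (on_hom F X Y f) (on_hom F Y Z g)"
begin

lemma target_Idn_in_Hom: "Y \<in> Ob D \<Longrightarrow> Idn D Y \<in> Hom D Y Y"
  using target_category unfolding is_category_def by blast

lemma target_Comp_in_Hom:
  "\<lbrakk>X \<in> Ob D; Y \<in> Ob D; Z \<in> Ob D; f \<in> Hom D X Y; g \<in> Hom D Y Z\<rbrakk> \<Longrightarrow> Comp D X Y Z f g \<in> Hom D X Z"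
  using target_category unfolding is_category_def by blast

lemma target_Comp_Idn:
  assumes "X \<in> Ob D" "Y \<in> Ob D" "f \<in> Hom D X Y"
  shows "Comp D X X Y (Idn D X) f = f" "Comp D X Y Y f (Idn D Y) = f"
  using target_category assms unfolding is_category_def by blast+

lemma target_Comp_assoc:
  "\<lbrakk>W \<in> Ob D; X \<in> Ob D; Y \<in> Ob D; Z \<in> Ob D; f \<in> Hom D W X; g \<in> Hom D X Y; h \<in> Hom D Y Z\<rbrakk>
    \<Longrightarrow> Comp D W Y Z (Comp D W X Y f g) h = Comp D W X Z f (Comp D X Y Z g h)"
  using target_category unfolding is_category_def by blast

lemma on_hom_in: "\<lbrakk>X \<in> Ob C; Y \<in> Ob C; f \<in> Hom C X Y\<rbrakk>
    \<Longrightarrow> on_hom F X Y f \<in> Hom D (on_ob F X) (on_ob F Y)"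
  using on_hom_bij bij_betwE by blast

lemma hom_eqI: "\<lbrakk>X \<in> Ob C; Y \<in> Ob C; f \<in> Hom C X Y; g \<in> Hom C X Y;
    on_hom F X Y f = on_hom F X Y g\<rbrakk> \<Longrightarrow> f = g"
  using on_hom_bij unfolding bij_betw_def inj_on_def by blast

definition lift :: "'o \<Rightarrow> 'o \<Rightarrow> 'n \<Rightarrow> 'm" where
  "lift X Y = inv_into (Hom C X Y) (on_hom F X Y)"

lemma lift_in: "\<lbrakk>X \<in> Ob C; Y \<in> Ob C; g \<in> Hom D (on_ob F X) (on_ob F Y)\<rbrakk> \<Longrightarrow> lift X Y g \<in> Hom C X Y"
  unfolding lift_def using on_hom_bij inv_into_into unfolding bij_betw_def by metis

lemma on_hom_lift: "\<lbrakk>X \<in> Ob C; Y \<in> Ob C; g \<in> Hom D (on_ob F X) (on_ob F Y)\<rbrakk>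
    \<Longrightarrow> on_hom F X Y (lift X Y g) = g"
  unfolding lift_def using on_hom_bij bij_betw_inv_into_right by metis

text \<open>Rewriting with these rules pushes the functor inside composites, cancels it against \<open>lift\<close>, and
  nests composites in the target to the right. After an application of
  \<open>hom_eqI\<close> it proves the equations between morphisms of \<open>C\<close> below.\<close>

lemmas image_simps =
  Idn_in_Hom Comp_in_Hom on_ob_in on_hom_Idn on_hom_Comp on_hom_in lift_in on_hom_lift
  target_Idn_in_Hom target_Comp_in_Hom target_Comp_Idn target_Comp_assoc

lemma source_category: "is_category C"
  unfolding is_category_def
proof (intro conjI ballI, goal_cases)
  case (1 X)
  then show ?case by (rule Idn_in_Hom)
next
  case (2 X Y Z f g)
  then show ?case by (rule Comp_in_Hom)
next
  case (3 X Y f)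
  then show ?case by (intro hom_eqI[of X Y]) (simp_all add: image_simps)
next
  case (4 X Y f)
  then show ?case by (intro hom_eqI[of X Y]) (simp_all add: image_simps)
next
  case (5 W X Y Z f g h)
  then show ?case by (intro hom_eqI[of W Z]) (simp_all add: image_simps)
qed

text \<open>The quasi-inverse \<open>GF\<close> chooses for each object \<open>Y\<close> of \<open>D\<close> an object \<open>G Y\<close> with an isomorphism
  \<open>\<epsilon> Y\<close> from its image to \<open>Y\<close>; on morphisms it conjugates with these isomorphisms
  and lifts the result to \<open>C\<close>.\<close>

lemma equivalence_if_essentially_surjective:
  assumes ess_surj: "\<And>Y. Y \<in> Ob D \<Longrightarrow> \<exists>X\<in>Ob C. \<exists>f. is_iso D (on_ob F X) Y f"
  shows "equivalent_categories C D"
proof -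
  have "\<forall>Y\<in>Ob D. \<exists>X f g. X \<in> Ob C \<and> f \<in> Hom D (on_ob F X) Y \<and> g \<in> Hom D Y (on_ob F X) \<and>
      Comp D (on_ob F X) Y (on_ob F X) f g = Idn D (on_ob F X) \<and>
      Comp D Y (on_ob F X) Y g f = Idn D Y"
    using ess_surj unfolding is_iso_def by blast
  then obtain G \<epsilon> \<delta> where
    G [simp]: "\<And>Y. Y \<in> Ob D \<Longrightarrow> G Y \<in> Ob C" and
    \<epsilon> [simp]: "\<And>Y. Y \<in> Ob D \<Longrightarrow> \<epsilon> Y \<in> Hom D (on_ob F (G Y)) Y" and
    \<delta> [simp]: "\<And>Y. Y \<in> Ob D \<Longrightarrow> \<delta> Y \<in> Hom D Y (on_ob F (G Y))" and
    \<epsilon>\<delta> [simp]: "\<And>Y. Y \<in> Ob D \<Longrightarrow>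
      Comp D (on_ob F (G Y)) Y (on_ob F (G Y)) (\<epsilon> Y) (\<delta> Y) = Idn D (on_ob F (G Y))" and
    \<delta>\<epsilon> [simp]: "\<And>Y. Y \<in> Ob D \<Longrightarrow> Comp D Y (on_ob F (G Y)) Y (\<delta> Y) (\<epsilon> Y) = Idn D Y"
    by metis
  \<comment> \<open>The inverse laws in the form that rewrites composites nested to the right.\<close>
  have \<delta>\<epsilon>' [simp]: "Comp D Y (on_ob F (G Y)) Z (\<delta> Y) (Comp D (on_ob F (G Y)) Y Z (\<epsilon> Y) h) = h"
    if "Y \<in> Ob D" "Z \<in> Ob D" "h \<in> Hom D Y Z" for Y Z h
  proof -
    have "Comp D Y (on_ob F (G Y)) Z (\<delta> Y) (Comp D (on_ob F (G Y)) Y Z (\<epsilon> Y) h)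
        = Comp D Y Y Z (Comp D Y (on_ob F (G Y)) Y (\<delta> Y) (\<epsilon> Y)) h"
      using that by (subst target_Comp_assoc) (simp_all add: on_ob_in)
    then show ?thesis using that by (simp add: target_Comp_Idn)
  qed
  define GF where "GF = \<lparr>on_ob = G, on_hom = (\<lambda>Y Z g. lift (G Y) (G Z)
      (Comp D (on_ob F (G Y)) Y (on_ob F (G Z)) (\<epsilon> Y) (Comp D Y Z (on_ob F (G Z)) g (\<delta> Z))))\<rparr>"
  define \<eta> where "\<eta> X = lift X (G (on_ob F X)) (\<delta> (on_ob F X))" for X
  have F: "is_functor C D F"
    unfolding is_functor_def by (simp add: image_simps)
  have G_functor: "is_functor D C GF"
    unfolding is_functor_def
  proof (intro conjI ballI, goal_cases)
    case (1 X)
    then show ?case by (simp add: GF_def)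
  next
    case (2 X Y f)
    then show ?case by (simp add: GF_def image_simps)
  next
    case (3 X)
    then show ?case by (intro hom_eqI[of "G X" "G X"]) (simp_all add: GF_def image_simps)
  next
    case (4 X Y Z f g)
    then show ?case by (intro hom_eqI[of "G X" "G Z"]) (simp_all add: GF_def image_simps)
  qed
  have iso_\<eta>: "is_iso C X (G (on_ob F X)) (\<eta> X)" if "X \<in> Ob C" for X
    unfolding is_iso_def
  proof (intro conjI bexI)
    let ?g = "lift (G (on_ob F X)) X (\<epsilon> (on_ob F X))"
    show "\<eta> X \<in> Hom C X (G (on_ob F X))" "?g \<in> Hom C (G (on_ob F X)) X"
      using that by (simp_all add: \<eta>_def image_simps)
    show "Comp C X (G (on_ob F X)) X (\<eta> X) ?g = Idn C X"
      using that by (intro hom_eqI[of X X]) (simp_all add: \<eta>_def image_simps)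
    show "Comp C (G (on_ob F X)) X (G (on_ob F X)) ?g (\<eta> X) = Idn C (G (on_ob F X))"
      using that
      by (intro hom_eqI[of "G (on_ob F X)" "G (on_ob F X)"]) (simp_all add: \<eta>_def image_simps)
  qed
  have nat_\<eta>: "natural_iso C C id_functor (then_functor F GF) \<eta>"
    unfolding natural_iso_def id_functor_def then_functor_def
  proof (intro conjI ballI, goal_cases)
    case (1 X)
    then show ?case by (simp add: iso_\<eta> GF_def)
  next
    case (2 X Y f)
    then show ?case
      by (intro hom_eqI[of X "G (on_ob F Y)"]) (simp_all add: \<eta>_def GF_def image_simps)
  qed
  have nat_\<epsilon>: "natural_iso D D (then_functor GF F) id_functor \<epsilon>"
    unfolding natural_iso_def id_functor_def then_functor_def
  proof (intro conjI ballI, goal_cases)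
    case (1 Y)
    have "is_iso D (on_ob F (G Y)) Y (\<epsilon> Y)"
      unfolding is_iso_def by (intro conjI bexI[of _ "\<delta> Y"]) (simp_all add: 1)
    then show ?case by (simp add: GF_def)
  next
    case (2 Y Z g)
    then show ?case by (simp add: GF_def image_simps)
  qed
  show ?thesis
    unfolding equivalent_categories_def
    by (intro conjI exI) (fact source_category target_category F G_functor nat_\<eta> nat_\<epsilon>)+
qed

end


section \<open>Compatible relations and maps between closed sets\<close>

lemma lower_UN: "lower A R (\<Union>i\<in>I. Y i) = A \<inter> (\<Inter>i\<in>I. lower A R (Y i))"
  by (auto simp: lower_def)

lemma upper_subset: "upper B R X \<subseteq> B"
  by (auto simp: upper_def)

lemma lower_upper_lower:
  "Y \<subseteq> Pos A \<Longrightarrow> lower (Neg A) (Inc A) (upper (Pos A) (Inc A) (lower (Neg A) (Inc A) Y))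
     = lower (Neg A) (Inc A) Y"
  by (auto simp: lower_def upper_def)

lemma lower_closed: "Y \<subseteq> Pos A \<Longrightarrow> lower (Neg A) (Inc A) Y \<in> closed_sets A"
  unfolding closed_sets_def cl_neg_def by (simp add: lower_upper_lower) (auto simp: lower_def)

lemma lower_upper_closed:
  "X \<in> closed_sets A \<Longrightarrow> lower (Neg A) (Inc A) (upper (Pos A) (Inc A) X) = X"
  by (auto simp: closed_sets_def cl_neg_def)

text \<open>Intersections of closed sets correspond to unions on the positive side, where any relation
  turns them back into intersections. This is why the maps induced by compatible relations
  preserve meets. The intersection with \<open>Neg A\<close> matters for the empty family, whose meet is the top
  element.\<close>

lemma closed_sets_Inter_eq:
  assumes "\<Y> \<subseteq> closed_sets A"
  shows "Neg A \<inter> \<Inter>\<Y> = lower (Neg A) (Inc A) (\<Union>X\<in>\<Y>. upper (Pos A) (Inc A) X)"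
proof -
  have "(\<lambda>X. lower (Neg A) (Inc A) (upper (Pos A) (Inc A) X)) ` \<Y> = (\<lambda>X. X) ` \<Y>"
    using assms lower_upper_closed by (intro image_cong) blast+
  then show ?thesis by (simp add: lower_UN)
qed

lemma closed_sets_Inter:
  assumes "\<Y> \<subseteq> closed_sets A"
  shows "Neg A \<inter> \<Inter>\<Y> \<in> closed_sets A"
  unfolding closed_sets_Inter_eq[OF assms] by (intro lower_closed UN_least upper_subset)

text \<open>The action of a relation \<open>R\<close> from \<open>A\<close> to \<open>B\<close> on the closed sets of \<open>B\<close>, in the direction
  opposite to \<open>R\<close>.\<close>

definition concept_map :: "'u polarity \<Rightarrow> 'u polarity \<Rightarrow> ('u \<times> 'u) set \<Rightarrow> 'u set \<Rightarrow> 'u set" where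
  "concept_map A B R X = lower (Neg A) R (upper (Pos B) (Inc B) X)"

lemma concept_map_closed:
  assumes "compatible A B R"
  shows "concept_map A B R X \<in> closed_sets A"
proof -
  have "concept_map A B R X \<subseteq> Neg A" by (auto simp: concept_map_def lower_def)
  moreover have "cl_neg A (concept_map A B R X) = concept_map A B R X"
    using assms by (simp add: compatible_def concept_map_def upper_subset)
  ultimately show ?thesis by (simp add: closed_sets_def)
qed

text \<open>The second compatibility condition, in the form in which it is used: on polars the induced map
  agrees with \<open>R\<^sup>\<down>\<close>. For singletons it says that \<open>R\<close> can be read off from its induced map.\<close>

lemma concept_map_lower:
  assumes "compatible A B R" "Y \<subseteq> Pos B"
  shows "concept_map A B R (lower (Neg B) (Inc B) Y) = lower (Neg A) R Y"
  using assms by (simp add: compatible_def concept_map_def cl_pos_def)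

lemma concept_map_Inter:
  assumes "compatible A B R" "\<Y> \<subseteq> closed_sets B"
  shows "concept_map A B R (Neg B \<inter> \<Inter>\<Y>) = Neg A \<inter> (\<Inter>X\<in>\<Y>. concept_map A B R X)"
proof -
  have "(\<Union>X\<in>\<Y>. upper (Pos B) (Inc B) X) \<subseteq> Pos B" by (intro UN_least upper_subset)
  from concept_map_lower[OF assms(1) this] show ?thesis
    unfolding closed_sets_Inter_eq[OF assms(2)] by (simp only: lower_UN concept_map_def)
qed

lemma compatible_Inc:
  assumes "is_polarity A"
  shows "compatible A A (Inc A)"
  using assms unfolding compatible_def is_polarity_def cl_neg_def cl_pos_def
  by (simp add: lower_upper_lower)

lemma concept_map_Inc: "X \<in> closed_sets A \<Longrightarrow> concept_map A A (Inc A) X = X"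
  by (simp add: concept_map_def lower_upper_closed)

text \<open>By definition the composite relation is computed one \<open>\<gamma>\<close> at a time. The map induced by \<open>R\<close>
  preserves meets, so the computation extends from singletons to arbitrary subsets of \<open>Pos C\<close>.\<close>

lemma lower_rel_then:
  assumes R: "compatible A B R" and S: "compatible B C S" and Y: "Y \<subseteq> Pos C"
  shows "lower (Neg A) (rel_then A B C R S) Y = concept_map A B R (lower (Neg B) S Y)"
proof -
  have S_single: "lower (Neg B) S {\<gamma>} \<in> closed_sets B" if "\<gamma> \<in> Y" for \<gamma>
  proof -
    have "{\<gamma>} \<subseteq> Pos C" using Y that by auto
    from concept_map_lower[OF S this] show ?thesis using concept_map_closed[OF S] by metis
  qed
  have "lower (Neg A) (rel_then A B C R S) Y
      = Neg A \<inter> (\<Inter>\<gamma>\<in>Y. concept_map A B R (lower (Neg B) S {\<gamma>}))"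
    using Y unfolding rel_then_def concept_map_def lower_def by auto
  also have "\<dots> = concept_map A B R (Neg B \<inter> (\<Inter>\<gamma>\<in>Y. lower (Neg B) S {\<gamma>}))"
    using concept_map_Inter[OF R, of "(\<lambda>\<gamma>. lower (Neg B) S {\<gamma>}) ` Y"] S_single
    by (simp add: image_subset_iff)
  also have "Neg B \<inter> (\<Inter>\<gamma>\<in>Y. lower (Neg B) S {\<gamma>}) = lower (Neg B) S Y"
    using lower_UN[of "Neg B" S "\<lambda>\<gamma>. {\<gamma>}" Y] by simp
  finally show ?thesis .
qed

lemma concept_map_rel_then:
  assumes "compatible A B R" "compatible B C S"
  shows "concept_map A C (rel_then A B C R S) X = concept_map A B R (concept_map B C S X)"
  using lower_rel_then[OF assms upper_subset] by (simp add: concept_map_def)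

lemma compatible_rel_then:
  assumes R: "compatible A B R" and S: "compatible B C S"
  shows "compatible A C (rel_then A B C R S)"
proof -
  have "cl_neg A (lower (Neg A) (rel_then A B C R S) Y) = lower (Neg A) (rel_then A B C R S) Y"
    if "Y \<subseteq> Pos C" for Y
    using concept_map_closed[OF R] unfolding lower_rel_then[OF assms that] closed_sets_def by blast
  moreover have "lower (Neg A) (rel_then A B C R S) (cl_pos C Y) = lower (Neg A) (rel_then A B C R S) Y"
    if "Y \<subseteq> Pos C" for Y
  proof -
    have "cl_pos C Y \<subseteq> Pos C" by (simp add: cl_pos_def upper_subset)
    moreover have "lower (Neg B) S (cl_pos C Y) = lower (Neg B) S Y"
      using S that by (auto simp: compatible_def)
    ultimately show ?thesis using that by (simp add: lower_rel_then[OF assms])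
  qed
  ultimately show ?thesis by (auto simp: compatible_def rel_then_def)
qed

lemma mem_compatible_iff:
  assumes "compatible A B R"
  shows "(a, \<beta>) \<in> R \<longleftrightarrow> a \<in> Neg A \<and> \<beta> \<in> Pos B \<and> a \<in> concept_map A B R (lower (Neg B) (Inc B) {\<beta>})"
proof (cases "\<beta> \<in> Pos B")
  case True
  then show ?thesis
    using concept_map_lower[OF assms, of "{\<beta>}"] assms by (auto simp: lower_def compatible_def)
next
  case False
  then show ?thesis using assms by (auto simp: compatible_def)
qed

lemma compatible_eqI:
  assumes R: "compatible A B R" and S: "compatible A B S"
    and eq: "\<And>X. X \<in> closed_sets B \<Longrightarrow> concept_map A B R X = concept_map A B S X"
  shows "R = S"
proof -
  have "(a, \<beta>) \<in> R \<longleftrightarrow> (a, \<beta>) \<in> S" for a \<beta>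
    unfolding mem_compatible_iff[OF R] mem_compatible_iff[OF S]
    using eq lower_closed[of "{\<beta>}" B] by auto
  then show ?thesis by auto
qed

text \<open>The relation is the table of the values of \<open>g\<close> at the polars of singletons. As \<open>g\<close> preserves meets,
  the table determines \<open>g\<close> at the polar of every subset of \<open>Pos B\<close>; both compatibility conditions
  follow, the second because a set and its closure have the same polar.\<close>

lemma compatible_exists:
  assumes closed: "\<And>X. X \<in> closed_sets B \<Longrightarrow> g X \<in> closed_sets A"
    and Inter: "\<And>\<Y>. \<Y> \<subseteq> closed_sets B \<Longrightarrow> g (Neg B \<inter> \<Inter>\<Y>) = Neg A \<inter> (\<Inter>X\<in>\<Y>. g X)"
  shows "\<exists>R. compatible A B R \<and> (\<forall>X\<in>closed_sets B. concept_map A B R X = g X)"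
proof (intro exI conjI ballI)
  define R where "R = {(a, \<beta>). a \<in> Neg A \<and> \<beta> \<in> Pos B \<and> a \<in> g (lower (Neg B) (Inc B) {\<beta>})}"
  have lower_R: "lower (Neg A) R Y = g (lower (Neg B) (Inc B) Y)" if Y: "Y \<subseteq> Pos B" for Y
  proof -
    have "lower (Neg A) R Y = Neg A \<inter> (\<Inter>\<beta>\<in>Y. g (lower (Neg B) (Inc B) {\<beta>}))"
      using Y unfolding R_def lower_def by auto
    also have "\<dots> = g (Neg B \<inter> (\<Inter>\<beta>\<in>Y. lower (Neg B) (Inc B) {\<beta>}))"
    proof -
      have "(\<lambda>\<beta>. lower (Neg B) (Inc B) {\<beta>}) ` Y \<subseteq> closed_sets B"
        using Y by (auto intro!: lower_closed)
      from Inter[OF this] show ?thesis by simp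
    qed
    also have "Neg B \<inter> (\<Inter>\<beta>\<in>Y. lower (Neg B) (Inc B) {\<beta>}) = lower (Neg B) (Inc B) Y"
      using lower_UN[of "Neg B" "Inc B" "\<lambda>\<beta>. {\<beta>}" Y] by simp
    finally show ?thesis .
  qed
  show "compatible A B R"
    unfolding compatible_def
  proof (intro conjI allI impI)
    show "R \<subseteq> Neg A \<times> Pos B" by (auto simp: R_def)
    fix Y assume Y: "Y \<subseteq> Pos B"
    show "cl_neg A (lower (Neg A) R Y) = lower (Neg A) R Y"
      using closed[OF lower_closed[OF Y]] unfolding lower_R[OF Y] closed_sets_def by blast
    have "cl_pos B Y \<subseteq> Pos B" by (simp add: cl_pos_def upper_subset)
    then show "lower (Neg A) R (cl_pos B Y) = lower (Neg A) R Y"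
      using Y by (simp add: lower_R cl_pos_def lower_upper_lower)
  qed
  show "concept_map A B R X = g X" if "X \<in> closed_sets B" for X
    using lower_upper_closed[OF that] by (simp add: concept_map_def lower_R upper_subset)
qed


section \<open>Complete lattices\<close>

lemma complete_lattice_inf_eqI:
  assumes "complete_lattice L" "S \<subseteq> carrier L" "i \<in> carrier L"
    and "\<And>x. x \<in> S \<Longrightarrow> i \<sqsubseteq>\<^bsub>L\<^esub> x"
    and "\<And>y. \<lbrakk>y \<in> carrier L; \<And>x. x \<in> S \<Longrightarrow> y \<sqsubseteq>\<^bsub>L\<^esub> x\<rbrakk> \<Longrightarrow> y \<sqsubseteq>\<^bsub>L\<^esub> i"
  shows "\<Sqinter>\<^bsub>L\<^esub>S = i"
proof -
  interpret complete_lattice L by fact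
  show ?thesis
  proof (rule le_antisym)
    show inf: "\<Sqinter>\<^bsub>L\<^esub>S \<in> carrier L" using assms(2) by simp
    show "\<Sqinter>\<^bsub>L\<^esub>S \<sqsubseteq>\<^bsub>L\<^esub> i" using assms(2) inf by (intro assms(5)) (auto intro: inf_lower)
    show "i \<sqsubseteq>\<^bsub>L\<^esub> \<Sqinter>\<^bsub>L\<^esub>S" using assms(2-4) by (intro inf_greatest)
  qed fact
qed

text \<open>The closure system \<open>\<C>\<close> is given only up to a bijection \<open>d\<close>, because the elements of the lattice
  will be codes for closed sets rather than the sets themselves.\<close>

lemma complete_lattice_of_closure_system:
  assumes eq: "eq L = (=)"
    and d: "bij_betw d (carrier L) \<C>"
    and le: "\<And>x y. \<lbrakk>x \<in> carrier L; y \<in> carrier L\<rbrakk> \<Longrightarrow> x \<sqsubseteq>\<^bsub>L\<^esub> y \<longleftrightarrow> d x \<subseteq> d y"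
    and sub: "\<C> \<subseteq> Pow E" and Inter: "\<And>\<Y>. \<Y> \<subseteq> \<C> \<Longrightarrow> E \<inter> \<Inter>\<Y> \<in> \<C>"
  shows "complete_lattice L"
    and "S \<subseteq> carrier L \<Longrightarrow> d (\<Sqinter>\<^bsub>L\<^esub>S) = E \<inter> (\<Inter>x\<in>S. d x)"
proof -
  interpret partial_order L
    using d by unfold_locales (auto simp: eq le bij_betw_def inj_on_def)
  have glb: "\<exists>i\<in>carrier L. d i = E \<inter> (\<Inter>x\<in>S. d x)" if "S \<subseteq> carrier L" for S
  proof -
    have "d ` S \<subseteq> \<C>" using d that by (auto simp: bij_betw_def)
    from Inter[OF this] show ?thesis using d by (auto simp: bij_betw_def)
  qed
  have greatest: "greatest L i (Lower L S)"
    if "S \<subseteq> carrier L" "i \<in> carrier L" "d i = E \<inter> (\<Inter>x\<in>S. d x)" for S i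
  proof (rule greatest_LowerI)
    show "i \<sqsubseteq>\<^bsub>L\<^esub> x" if "x \<in> S" for x
    proof -
      have "x \<in> carrier L" using that \<open>S \<subseteq> carrier L\<close> by blast
      with that \<open>i \<in> carrier L\<close> show ?thesis by (auto simp: le \<open>d i = _\<close>)
    qed
    show "y \<sqsubseteq>\<^bsub>L\<^esub> i" if y: "y \<in> Lower L S" for y
    proof -
      have "y \<in> carrier L" using y by (auto simp: Lower_def)
      moreover from this have "d y \<subseteq> E" using d sub by (auto simp: bij_betw_def)
      moreover have "d y \<subseteq> d x" if "x \<in> S" for x
        using y that \<open>S \<subseteq> carrier L\<close> by (auto simp: Lower_def le subset_iff)
      ultimately show ?thesis using \<open>i \<in> carrier L\<close> \<open>d i = _\<close> by (auto simp: le)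
    qed
  qed fact+
  show cl: "complete_lattice L"
  proof (rule complete_lattice_criterion1)
    show "\<exists>g. greatest L g (carrier L)"
      using glb[of "{}"] greatest[of "{}"] by auto
    show "\<exists>i. greatest L i (Lower L A)" if "A \<subseteq> carrier L" for A
      using glb[OF that] greatest[OF that] by auto
  qed
  show "d (\<Sqinter>\<^bsub>L\<^esub>S) = E \<inter> (\<Inter>x\<in>S. d x)" if S: "S \<subseteq> carrier L"
  proof -
    obtain i where i: "i \<in> carrier L" "d i = E \<inter> (\<Inter>x\<in>S. d x)" using glb[OF S] by auto
    interpret complete_lattice L by (rule cl)
    have "greatest L (\<Sqinter>\<^bsub>L\<^esub>S) (Lower L S)" using inf_glb S by simp
    then have "\<Sqinter>\<^bsub>L\<^esub>S = i" using greatest[OF S i] greatest_unique by blast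
    then show ?thesis using i by simp
  qed
qed

lemma inf_pres_order_iso:
  assumes L: "complete_lattice L" and M: "complete_lattice M"
    and \<phi>: "bij_betw \<phi> (carrier L) (carrier M)"
    and le: "\<And>x y. \<lbrakk>x \<in> carrier L; y \<in> carrier L\<rbrakk> \<Longrightarrow> \<phi> x \<sqsubseteq>\<^bsub>M\<^esub> \<phi> y \<longleftrightarrow> x \<sqsubseteq>\<^bsub>L\<^esub> y"
  shows "inf_pres L M \<phi>"
  unfolding inf_pres_def
proof (intro conjI allI impI)
  fix S assume S: "S \<subseteq> carrier L"
  interpret complete_lattice L by (rule L)
  have inf: "\<Sqinter>\<^bsub>L\<^esub>S \<in> carrier L" using S by simp
  have "\<Sqinter>\<^bsub>M\<^esub>(\<phi> ` S) = \<phi> (\<Sqinter>\<^bsub>L\<^esub>S)"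
  proof (rule complete_lattice_inf_eqI[OF M])
    show "\<phi> ` S \<subseteq> carrier M" "\<phi> (\<Sqinter>\<^bsub>L\<^esub>S) \<in> carrier M"
      using \<phi> S inf by (auto simp: bij_betw_def)
    show "\<phi> (\<Sqinter>\<^bsub>L\<^esub>S) \<sqsubseteq>\<^bsub>M\<^esub> x" if "x \<in> \<phi> ` S" for x
      using that S inf by (auto simp: le subset_iff inf_lower)
    fix y assume y: "y \<in> carrier M" "\<And>x. x \<in> \<phi> ` S \<Longrightarrow> y \<sqsubseteq>\<^bsub>M\<^esub> x"
    then obtain z where z: "z \<in> carrier L" "y = \<phi> z"
      using bij_betw_imp_surj_on[OF \<phi>] by (metis imageE)
    have "z \<sqsubseteq>\<^bsub>L\<^esub> x" if "x \<in> S" for x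
      using y(2)[of "\<phi> x"] z le[of z x] S that by blast
    then have "z \<sqsubseteq>\<^bsub>L\<^esub> \<Sqinter>\<^bsub>L\<^esub>S"
      using S z by (intro inf_greatest)
    then show "y \<sqsubseteq>\<^bsub>M\<^esub> \<phi> (\<Sqinter>\<^bsub>L\<^esub>S)" using z inf by (simp add: le)
  qed
  then show "\<phi> (\<Sqinter>\<^bsub>L\<^esub>S) = \<Sqinter>\<^bsub>M\<^esub>(\<phi> ` S)" by simp
qed fact+

lemma INF_category: "is_category (INF_cat U)"
proof -
  have "inf_pres L L (\<lambda>x\<in>carrier L. x)" if "complete_lattice L" for L :: "'a gorder"
    using that by (intro inf_pres_order_iso) (auto simp: bij_betw_def inj_on_def)
  moreover have "inf_pres L N (compose (carrier L) g f)"
    if f: "f \<in> carrier L \<rightarrow>\<^sub>E carrier M" "inf_pres L M f" and g: "inf_pres M N g"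
    for L M N :: "'a gorder" and f g
    unfolding inf_pres_def
  proof (intro conjI allI impI)
    show L: "complete_lattice L" and "complete_lattice N" using f g by (auto simp: inf_pres_def)
    fix S assume S: "S \<subseteq> carrier L"
    interpret complete_lattice L by (rule L)
    have "f ` S \<subseteq> carrier M" using f S by auto
    moreover have "compose (carrier L) g f ` S = g ` f ` S"
      using S by (auto simp: compose_def image_image intro!: image_cong)
    ultimately show "compose (carrier L) g f (\<Sqinter>\<^bsub>L\<^esub>S) = \<Sqinter>\<^bsub>N\<^esub>(compose (carrier L) g f ` S)"
      using f g S by (simp add: compose_def inf_pres_def)
  qed
  ultimately show ?thesis
    unfolding is_category_def INF_cat_def
    by (auto simp: compose_def fun_eq_iff PiE_iff extensional_def Pi_iff)
qed

lemma is_iso_order_iso: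
  assumes L: "L \<in> Ob (INF_cat U)" and M: "M \<in> Ob (INF_cat U)"
    and \<phi>: "bij_betw \<phi> (carrier L) (carrier M)"
    and le: "\<And>x y. \<lbrakk>x \<in> carrier L; y \<in> carrier L\<rbrakk> \<Longrightarrow> \<phi> x \<sqsubseteq>\<^bsub>M\<^esub> \<phi> y \<longleftrightarrow> x \<sqsubseteq>\<^bsub>L\<^esub> y"
  shows "is_iso (INF_cat U) L M (restrict \<phi> (carrier L))"
proof -
  let ?f = "restrict \<phi> (carrier L)" and ?\<psi> = "inv_into (carrier L) \<phi>"
  let ?g = "restrict ?\<psi> (carrier M)"
  have \<psi>: "bij_betw ?\<psi> (carrier M) (carrier L)" using \<phi> by (rule bij_betw_inv_into)
  have inv: "?\<psi> (\<phi> x) = x" if "x \<in> carrier L" for x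
    using \<phi> that by (simp add: bij_betw_inv_into_left)
  have inv': "\<phi> (?\<psi> y) = y" if "y \<in> carrier M" for y
    using \<phi> that by (simp add: bij_betw_inv_into_right)
  have bij_f: "bij_betw ?f (carrier L) (carrier M)" and bij_g: "bij_betw ?g (carrier M) (carrier L)"
    using \<phi> \<psi> by (simp_all cong: bij_betw_cong)
  have \<psi>_in: "?\<psi> y \<in> carrier L" if "y \<in> carrier M" for y using \<psi> that by (auto simp: bij_betw_def)
  have "inf_pres L M ?f"
    using L M bij_f by (intro inf_pres_order_iso) (auto simp: INF_cat_def le)
  moreover have "inf_pres M L ?g"
    using L M bij_g le[OF \<psi>_in \<psi>_in] by (intro inf_pres_order_iso) (auto simp: INF_cat_def inv')
  moreover have "compose (carrier L) ?g ?f = (\<lambda>x\<in>carrier L. x)"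
    "compose (carrier M) ?f ?g = (\<lambda>x\<in>carrier M. x)"
    using bij_betwE[OF \<phi>] \<psi>_in inv inv' by (auto simp: compose_def fun_eq_iff)
  moreover have "?f \<in> carrier L \<rightarrow>\<^sub>E carrier M" "?g \<in> carrier M \<rightarrow>\<^sub>E carrier L"
    using bij_betwE[OF \<phi>] \<psi>_in by auto
  ultimately show ?thesis
    unfolding is_iso_def INF_cat_def by (intro conjI bexI[of _ ?g]) simp_all
qed


section \<open>The concept lattice functor\<close>

text \<open>Some bijection from the closed sets onto a member of \<open>U\<close>; it is meaningful only for polarities in
  \<open>concept_small U\<close>.\<close>

definition encode :: "'u set set \<Rightarrow> 'u polarity \<Rightarrow> 'u set \<Rightarrow> 'u" where
  "encode U A = (SOME e. \<exists>X\<in>U. bij_betw e (closed_sets A) X)"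

definition decode :: "'u set set \<Rightarrow> 'u polarity \<Rightarrow> 'u \<Rightarrow> 'u set" where
  "decode U A = inv_into (closed_sets A) (encode U A)"

definition concept_lattice :: "'u set set \<Rightarrow> 'u polarity \<Rightarrow> 'u gorder" where
  "concept_lattice U A = \<lparr>carrier = encode U A ` closed_sets A, eq = (=),
     le = (\<lambda>x y. decode U A x \<subseteq> decode U A y)\<rparr>"

text \<open>The source of this functor is the opposite of a category of polarities, so its morphisms from
  \<open>B\<close> to \<open>A\<close> are the compatible relations from \<open>A\<close> to \<open>B\<close>.\<close>

definition concept_functor ::
    "'u set set \<Rightarrow> ('u polarity, ('u \<times> 'u) set, 'u gorder, 'u \<Rightarrow> 'u) cat_functor" where
  "concept_functor U = \<lparr>on_ob = concept_lattice U,
     on_hom = (\<lambda>B A R. \<lambda>x\<in>carrier (concept_lattice U B).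
       encode U A (concept_map A B R (decode U B x)))\<rparr>"

lemma bij_encode:
  assumes "A \<in> concept_small U"
  shows "\<exists>X\<in>U. bij_betw (encode U A) (closed_sets A) X"
proof -
  have "\<exists>e. \<exists>X\<in>U. bij_betw e (closed_sets A) X"
    using assms by (auto simp: concept_small_def eqpoll_def)
  then show ?thesis unfolding encode_def by (rule someI_ex)
qed

context
  fixes U :: "'u set set" and A :: "'u polarity"
  assumes small: "A \<in> concept_small U"
begin

lemma carrier_concept_lattice: "carrier (concept_lattice U A) \<in> U"
  using bij_encode[OF small] by (auto simp: concept_lattice_def bij_betw_def)

lemma inj_encode: "inj_on (encode U A) (closed_sets A)"
  using bij_encode[OF small] by (auto simp: bij_betw_def)

lemma encode_in: "X \<in> closed_sets A \<Longrightarrow> encode U A X \<in> carrier (concept_lattice U A)"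
  by (simp add: concept_lattice_def)

lemma decode_encode: "X \<in> closed_sets A \<Longrightarrow> decode U A (encode U A X) = X"
  by (simp add: decode_def inj_encode)

lemma encode_decode: "x \<in> carrier (concept_lattice U A) \<Longrightarrow> encode U A (decode U A x) = x"
  by (simp add: decode_def concept_lattice_def f_inv_into_f)

lemma bij_decode: "bij_betw (decode U A) (carrier (concept_lattice U A)) (closed_sets A)"
  unfolding decode_def concept_lattice_def
  by (simp add: bij_betw_inv_into inj_encode inj_on_imp_bij_betw)

lemma decode_in: "x \<in> carrier (concept_lattice U A) \<Longrightarrow> decode U A x \<in> closed_sets A"
  using bij_decode bij_betwE by blast

lemma concept_lattice_le:
  "x \<sqsubseteq>\<^bsub>concept_lattice U A\<^esub> y \<longleftrightarrow> decode U A x \<subseteq> decode U A y"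
  by (simp add: concept_lattice_def)

lemma complete_concept_lattice: "complete_lattice (concept_lattice U A)"
  and decode_inf: "S \<subseteq> carrier (concept_lattice U A) \<Longrightarrow>
    decode U A (\<Sqinter>\<^bsub>concept_lattice U A\<^esub>S) = Neg A \<inter> (\<Inter>x\<in>S. decode U A x)"
proof -
  have "eq (concept_lattice U A) = (=)" by (simp add: concept_lattice_def)
  moreover have "closed_sets A \<subseteq> Pow (Neg A)" by (auto simp: closed_sets_def)
  ultimately show "complete_lattice (concept_lattice U A)"
    "S \<subseteq> carrier (concept_lattice U A) \<Longrightarrow>
      decode U A (\<Sqinter>\<^bsub>concept_lattice U A\<^esub>S) = Neg A \<inter> (\<Inter>x\<in>S. decode U A x)"
    using complete_lattice_of_closure_system[OF _ bij_decode concept_lattice_le _ closed_sets_Inter]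
    by blast+
qed

end

text \<open>Preservation of infima between concept lattices, freed of the encoding: it becomes the condition on
  intersections of closed sets that occurs in \<open>concept_map_Inter\<close> and \<open>compatible_exists\<close>.\<close>

lemma inf_pres_iff_Inter:
  assumes A: "A \<in> concept_small U" and B: "B \<in> concept_small U"
    and f: "f \<in> carrier (concept_lattice U B) \<rightarrow> carrier (concept_lattice U A)"
  shows "inf_pres (concept_lattice U B) (concept_lattice U A) f \<longleftrightarrow>
    (\<forall>S\<subseteq>carrier (concept_lattice U B).
       decode U A (f (\<Sqinter>\<^bsub>concept_lattice U B\<^esub>S)) = Neg A \<inter> (\<Inter>x\<in>S. decode U A (f x)))"
proof -
  let ?L = "concept_lattice U B" and ?M = "concept_lattice U A"
  interpret L: complete_lattice ?L by (rule complete_concept_lattice[OF B])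
  interpret M: complete_lattice ?M by (rule complete_concept_lattice[OF A])
  have "f (\<Sqinter>\<^bsub>?L\<^esub>S) = \<Sqinter>\<^bsub>?M\<^esub>(f ` S) \<longleftrightarrow>
      decode U A (f (\<Sqinter>\<^bsub>?L\<^esub>S)) = Neg A \<inter> (\<Inter>x\<in>S. decode U A (f x))"
    if S: "S \<subseteq> carrier ?L" for S
  proof -
    have fS: "f ` S \<subseteq> carrier ?M" using f S by auto
    have "f (\<Sqinter>\<^bsub>?L\<^esub>S) \<in> carrier ?M" "\<Sqinter>\<^bsub>?M\<^esub>(f ` S) \<in> carrier ?M"
      using f S fS by auto
    then have "f (\<Sqinter>\<^bsub>?L\<^esub>S) = \<Sqinter>\<^bsub>?M\<^esub>(f ` S) \<longleftrightarrow>
        decode U A (f (\<Sqinter>\<^bsub>?L\<^esub>S)) = decode U A (\<Sqinter>\<^bsub>?M\<^esub>(f ` S))"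
      using encode_decode[OF A] by metis
    then show ?thesis by (simp add: decode_inf[OF A fS] image_image)
  qed
  then show ?thesis
    unfolding inf_pres_def
    using complete_concept_lattice[OF A] complete_concept_lattice[OF B] by auto
qed

lemma concept_functor_bij:
  assumes A: "A \<in> concept_small U" and B: "B \<in> concept_small U"
  shows "bij_betw (on_hom (concept_functor U) B A) {R. compatible A B R}
    (Hom (INF_cat U) (concept_lattice U B) (concept_lattice U A))"
  (is "bij_betw ?h _ _")
proof -
  let ?L = "concept_lattice U B" and ?M = "concept_lattice U A"
  have h: "?h R x = encode U A (concept_map A B R (decode U B x))" if "x \<in> carrier ?L" for R x
    using that by (simp add: concept_functor_def)
  have decode_h: "decode U A (?h R x) = concept_map A B R (decode U B x)"
    if "compatible A B R" "x \<in> carrier ?L" for R x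
    using that by (simp add: h decode_encode[OF A] concept_map_closed)
  interpret L: complete_lattice ?L by (rule complete_concept_lattice[OF B])
  have "?h R \<in> Hom (INF_cat U) ?L ?M" if R: "compatible A B R" for R
  proof -
    have h_in: "?h R \<in> carrier ?L \<rightarrow>\<^sub>E carrier ?M"
      using encode_in[OF A] concept_map_closed[OF R] by (auto simp: concept_functor_def)
    moreover have "decode U A (?h R (\<Sqinter>\<^bsub>?L\<^esub>S)) = Neg A \<inter> (\<Inter>x\<in>S. decode U A (?h R x))"
      if S: "S \<subseteq> carrier ?L" for S
    proof -
      have "decode U B ` S \<subseteq> closed_sets B" using S decode_in[OF B] by auto
      from concept_map_Inter[OF R this] show ?thesis
        using S by (simp add: decode_h[OF R] decode_inf[OF B] subset_iff)
    qed
    ultimately have "inf_pres ?L ?M (?h R)"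
      by (subst inf_pres_iff_Inter[OF A B]) auto
    then show ?thesis using h_in by (simp add: INF_cat_def)
  qed
  moreover have "inj_on ?h {R. compatible A B R}"
  proof (rule inj_onI)
    fix R S assume R: "R \<in> {R. compatible A B R}" and S: "S \<in> {R. compatible A B R}" and eq: "?h R = ?h S"
    show "R = S"
    proof (rule compatible_eqI)
      fix X assume X: "X \<in> closed_sets B"
      from decode_h[of R "encode U B X"] decode_h[of S "encode U B X"]
      show "concept_map A B R X = concept_map A B S X"
        using R S eq encode_in[OF B X] by (simp add: decode_encode[OF B X])
    qed (use R S in auto)
  qed
  moreover have "\<exists>R. compatible A B R \<and> ?h R = f" if f: "f \<in> Hom (INF_cat U) ?L ?M" for f
  proof -
    have f_in: "f \<in> carrier ?L \<rightarrow>\<^sub>E carrier ?M" and f_inf: "inf_pres ?L ?M f"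
      using f by (auto simp: INF_cat_def)
    have f_Pi: "f \<in> carrier ?L \<rightarrow> carrier ?M" using f_in by auto
    define g where "g X = decode U A (f (encode U B X))" for X
    have "\<exists>R. compatible A B R \<and> (\<forall>X\<in>closed_sets B. concept_map A B R X = g X)"
    proof (rule compatible_exists)
      show "g X \<in> closed_sets A" if "X \<in> closed_sets B" for X
        using encode_in[OF B that] f_Pi decode_in[OF A] by (auto simp: g_def)
      fix \<Y> assume \<Y>: "\<Y> \<subseteq> closed_sets B"
      let ?S = "encode U B ` \<Y>"
      have S: "?S \<subseteq> carrier ?L" using \<Y> encode_in[OF B] by auto
      have "decode U B (\<Sqinter>\<^bsub>?L\<^esub>?S) = Neg B \<inter> \<Inter>\<Y>"
        using \<Y> decode_encode[OF B] by (subst decode_inf[OF B S]) auto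
      then have "encode U B (Neg B \<inter> \<Inter>\<Y>) = \<Sqinter>\<^bsub>?L\<^esub>?S"
        using encode_decode[OF B, of "\<Sqinter>\<^bsub>?L\<^esub>?S"] S by simp
      then show "g (Neg B \<inter> \<Inter>\<Y>) = Neg A \<inter> (\<Inter>X\<in>\<Y>. g X)"
        using f_inf S unfolding inf_pres_iff_Inter[OF A B f_Pi] by (simp add: g_def image_image)
    qed
    then obtain R where R: "compatible A B R"
      and R_g: "\<And>X. X \<in> closed_sets B \<Longrightarrow> concept_map A B R X = g X"
      by blast
    have "?h R x = f x" for x
    proof (cases "x \<in> carrier ?L")
      case True
      moreover from this have "f x \<in> carrier ?M" using f_Pi by auto
      ultimately show ?thesis
        by (simp add: h R_g g_def decode_in[OF B] encode_decode[OF B] encode_decode[OF A])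
    next
      case False
      then show ?thesis using f_in by (auto simp: concept_functor_def)
    qed
    then show ?thesis using R by blast
  qed
  ultimately show ?thesis unfolding bij_betw_def by blast
qed

lemma concept_functor_fully_faithful:
  "fully_faithful_functor (opposite (full_subcategory (Pol U) (concept_small U))) (INF_cat U)
     (concept_functor U)"
  (is "fully_faithful_functor ?C _ _")
proof
  show "is_category (INF_cat U)" by (rule INF_category)
  have Ob: "X \<in> Ob ?C \<longleftrightarrow> is_polarity X \<and> Neg X \<in> U \<and> Pos X \<in> U \<and> X \<in> concept_small U" for X
    by (auto simp: opposite_def full_subcategory_def Pol_def)
  have Hom: "Hom ?C X Y = {R. compatible Y X R}" for X Y
    by (simp add: opposite_def full_subcategory_def Pol_def)
  have Idn: "Idn ?C X = Inc X" for X
    by (simp add: opposite_def full_subcategory_def Pol_def)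
  have Comp: "Comp ?C X Y Z f g = rel_then Z Y X g f" for X Y Z f g
    by (simp add: opposite_def full_subcategory_def Pol_def)
  have on_ob: "on_ob (concept_functor U) = concept_lattice U" by (simp add: concept_functor_def)
  fix X assume X: "X \<in> Ob ?C"
  then have sX: "X \<in> concept_small U" by (simp add: Ob)
  show "Idn ?C X \<in> Hom ?C X X" using X by (simp add: Idn Hom Ob compatible_Inc)
  show "on_ob (concept_functor U) X \<in> Ob (INF_cat U)"
    using sX by (simp add: on_ob INF_cat_def complete_concept_lattice carrier_concept_lattice)
  show "on_hom (concept_functor U) X X (Idn ?C X) = Idn (INF_cat U) (on_ob (concept_functor U) X)"
    using sX by (auto simp: Idn concept_functor_def INF_cat_def concept_map_Inc decode_in encode_decode
        fun_eq_iff)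
  fix Y assume Y: "Y \<in> Ob ?C"
  then have sY: "Y \<in> concept_small U" by (simp add: Ob)
  show "bij_betw (on_hom (concept_functor U) X Y) (Hom ?C X Y)
      (Hom (INF_cat U) (on_ob (concept_functor U) X) (on_ob (concept_functor U) Y))"
    using concept_functor_bij[OF sY sX] by (simp add: Hom on_ob)
  fix Z f g assume Z: "Z \<in> Ob ?C" and "f \<in> Hom ?C X Y" "g \<in> Hom ?C Y Z"
  then have f: "compatible Y X f" and g: "compatible Z Y g" by (simp_all add: Hom)
  show "Comp ?C X Y Z f g \<in> Hom ?C X Z"
    using f g by (simp add: Comp Hom compatible_rel_then)
  show "on_hom (concept_functor U) X Z (Comp ?C X Y Z f g)
      = Comp (INF_cat U) (on_ob (concept_functor U) X) (on_ob (concept_functor U) Y)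
          (on_ob (concept_functor U) Z) (on_hom (concept_functor U) X Y f)
          (on_hom (concept_functor U) Y Z g)"
    using concept_map_closed[OF f]
    by (auto simp: Comp concept_functor_def INF_cat_def compose_def fun_eq_iff
        concept_map_rel_then[OF g f] encode_in[OF sY] decode_encode[OF sY])
qed


section \<open>Every complete lattice is a concept lattice\<close>

definition order_polarity :: "'u gorder \<Rightarrow> 'u polarity" where
  "order_polarity L = \<lparr>Neg = carrier L, Pos = carrier L,
     Inc = {(x, y). x \<in> carrier L \<and> y \<in> carrier L \<and> x \<sqsubseteq>\<^bsub>L\<^esub> y}\<rparr>"

text \<open>A closed set consists of the common lower bounds of some \<open>Y\<close>, which is the down-set of the infimum
  of \<open>Y\<close>. Conversely the down-set of \<open>x\<close> consists of the lower bounds of \<open>{x}\<close>.\<close>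

lemma closed_sets_order_polarity:
  assumes L: "complete_lattice L"
  shows "bij_betw (\<lambda>x. {y \<in> carrier L. y \<sqsubseteq>\<^bsub>L\<^esub> x}) (carrier L) (closed_sets (order_polarity L))"
    (is "bij_betw ?down _ _")
proof -
  interpret complete_lattice L by (rule L)
  have "inj_on ?down (carrier L)"
    by (rule inj_onI) (metis (mono_tags, lifting) le_antisym le_refl mem_Collect_eq)
  moreover have "?down x \<in> closed_sets (order_polarity L)" if "x \<in> carrier L" for x
  proof -
    have "?down x = lower (Neg (order_polarity L)) (Inc (order_polarity L)) {x}"
      using that by (auto simp: order_polarity_def lower_def)
    then show ?thesis using that lower_closed[of "{x}" "order_polarity L"] by (simp add: order_polarity_def)
  qed
  moreover have "X \<in> ?down ` carrier L" if X: "X \<in> closed_sets (order_polarity L)" for X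
  proof -
    define Y where "Y = upper (Pos (order_polarity L)) (Inc (order_polarity L)) X"
    have Y: "Y \<subseteq> carrier L" by (auto simp: Y_def upper_def order_polarity_def)
    have "X = lower (Neg (order_polarity L)) (Inc (order_polarity L)) Y"
      using lower_upper_closed[OF X] by (simp add: Y_def)
    also have "\<dots> = {y \<in> carrier L. \<forall>x\<in>Y. y \<sqsubseteq>\<^bsub>L\<^esub> x}"
      using Y by (auto simp: lower_def order_polarity_def)
    also have "\<dots> = ?down (\<Sqinter>\<^bsub>L\<^esub>Y)"
    proof -
      have "y \<sqsubseteq>\<^bsub>L\<^esub> \<Sqinter>\<^bsub>L\<^esub>Y \<longleftrightarrow> (\<forall>x\<in>Y. y \<sqsubseteq>\<^bsub>L\<^esub> x)" if "y \<in> carrier L" for y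
        using that Y inf_lower[OF Y] inf_greatest[OF Y] inf_closed[OF Y] le_trans by (meson subsetD)
      then show ?thesis by auto
    qed
    finally show ?thesis using inf_closed[OF Y] by blast
  qed
  ultimately show ?thesis by (auto simp: bij_betw_def)
qed

lemma concept_functor_essentially_surjective:
  assumes L: "L \<in> Ob (INF_cat U)"
  shows "\<exists>A\<in>Ob (opposite (full_subcategory (Pol U) (concept_small U))).
    \<exists>f. is_iso (INF_cat U) (on_ob (concept_functor U) A) L f"
proof -
  let ?A = "order_polarity L" and ?down = "\<lambda>x. {y \<in> carrier L. y \<sqsubseteq>\<^bsub>L\<^esub> x}"
  have cl: "complete_lattice L" and U: "carrier L \<in> U" using L by (auto simp: INF_cat_def)
  interpret complete_lattice L by (rule cl)
  note bij = closed_sets_order_polarity[OF cl]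
  have small: "?A \<in> concept_small U"
    using bij_betw_inv_into[OF bij] U by (auto simp: concept_small_def eqpoll_def)
  then have A: "?A \<in> Ob (opposite (full_subcategory (Pol U) (concept_small U)))"
    using U by (auto simp: opposite_def full_subcategory_def Pol_def is_polarity_def order_polarity_def)
  let ?M = "concept_lattice U ?A" and ?\<phi> = "inv_into (carrier L) ?down \<circ> decode U ?A"
  have \<phi>: "bij_betw ?\<phi> (carrier ?M) (carrier L)"
    using bij_decode[OF small] bij_betw_inv_into[OF bij] by (rule bij_betw_trans)
  have M: "?M \<in> Ob (INF_cat U)"
    using small by (simp add: INF_cat_def complete_concept_lattice carrier_concept_lattice)
  have down_\<phi>: "?down (?\<phi> x) = decode U ?A x" if "x \<in> carrier ?M" for x
    using bij_betw_inv_into_right[OF bij decode_in[OF small that]] by simp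
  have down_le: "?down x \<subseteq> ?down y \<longleftrightarrow> x \<sqsubseteq>\<^bsub>L\<^esub> y" if "x \<in> carrier L" "y \<in> carrier L" for x y
    using that le_trans by blast
  have "?\<phi> x \<sqsubseteq>\<^bsub>L\<^esub> ?\<phi> y \<longleftrightarrow> x \<sqsubseteq>\<^bsub>?M\<^esub> y" if "x \<in> carrier ?M" "y \<in> carrier ?M" for x y
    using down_le[of "?\<phi> x" "?\<phi> y"] bij_betwE[OF \<phi>] that
    unfolding concept_lattice_le[OF small] down_\<phi>[OF that(1), symmetric] down_\<phi>[OF that(2), symmetric]
    by blast
  from is_iso_order_iso[OF M L \<phi> this] show ?thesis
    using A by (auto simp: concept_functor_def)
qed


section \<open>The duality\<close>

text \<open>The closed sets form a subfamily of the power set of \<open>Neg A\<close>, which a universe contains up to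
  bijection.\<close>

lemma universe_concept_small:
  assumes "universe U" "Neg A \<in> U"
  shows "A \<in> concept_small U"
proof -
  obtain Y e where Y: "Y \<in> U" and e: "bij_betw e (Pow (Neg A)) Y"
    using assms unfolding universe_def eqpoll_def by blast
  have sub: "closed_sets A \<subseteq> Pow (Neg A)" by (auto simp: closed_sets_def)
  have "bij_betw e (closed_sets A) (e ` closed_sets A)"
    using e sub by (auto simp: bij_betw_def intro: inj_on_subset)
  moreover have "e ` closed_sets A \<in> U"
    using assms(1) Y e sub unfolding universe_def by (metis bij_betw_def image_mono)
  ultimately show ?thesis by (auto simp: concept_small_def eqpoll_def)
qed

theorem theorem3p3:
  fixes U :: "'u set set"
  shows "(universe U \<longrightarrow> dually_equivalent (Pol U) (INF_cat U)) \<and>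
         dually_equivalent (full_subcategory (Pol U) (concept_small U)) (INF_cat U)"
proof -
  interpret fully_faithful_functor "opposite (full_subcategory (Pol U) (concept_small U))" "INF_cat U"
    "concept_functor U"
    by (rule concept_functor_fully_faithful)
  have small: "dually_equivalent (full_subcategory (Pol U) (concept_small U)) (INF_cat U)"
    unfolding dually_equivalent_def
    by (rule equivalence_if_essentially_surjective[OF concept_functor_essentially_surjective])
  have "full_subcategory (Pol U) (concept_small U) = Pol U" if "universe U"
    using universe_concept_small[OF that] by (auto simp: full_subcategory_def Pol_def)
  then show ?thesis using small by auto
qed

end
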